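(* Let $S$ be an infinite set, let $(R_k)_{k\in S}$ be a family of integral domains, and let $R=\prod_{k\in S}R_k$. Then the set of minimal wild primes of $R$ has cardinality $2^{2^{|S|}}$.
   Context: All rings are commutative with identity. For $k\in S$, $\pi_k:R\to R_k$ denotes the projection map. A tame prime of $R=\prod_{k\in S}R_k$ is a prime ideal of $R$ of the form $\pi_k^{-1}(\mathfrak p)$ for some $k\in S$ and some prime ideal $\mathfrak p$ of $R_k$. A wild prime of $R$ is a prime ideal of $R$ which is not tame. A minimal wild prime of $R$ is a wild prime of $R$ which is also a minimal prime ideal of $R$. *)

theory Defs
  imports "HOL-Algebra.RingHom" "HOL-Library.Equipollence"
begin

(* Elements are extensional functions, as in product_group: they are undefined outside S,
   so each family (x k) with k in S is represented exactly once. *)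
definition product_ring :: "'i set \<Rightarrow> ('i \<Rightarrow> ('a, 'm) ring_scheme) \<Rightarrow> ('i \<Rightarrow> 'a) ring"
  where "product_ring S R =
    \<lparr>carrier = (\<Pi>\<^sub>E k\<in>S. carrier (R k)),
     monoid.mult = (\<lambda>x y. \<lambda>k\<in>S. x k \<otimes>\<^bsub>R k\<^esub> y k),
     one = (\<lambda>k\<in>S. \<one>\<^bsub>R k\<^esub>),
     zero = (\<lambda>k\<in>S. \<zero>\<^bsub>R k\<^esub>),
     add = (\<lambda>x y. \<lambda>k\<in>S. x k \<oplus>\<^bsub>R k\<^esub> y k)\<rparr>"

definition proj :: "'i \<Rightarrow> ('i \<Rightarrow> 'a) \<Rightarrow> 'a"
  where "proj k x = x k"

definition tame_prime :: "'i set \<Rightarrow> ('i \<Rightarrow> ('a, 'm) ring_scheme) \<Rightarrow> ('i \<Rightarrow> 'a) set \<Rightarrow> bool"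
  where "tame_prime S R P \<longleftrightarrow>
    primeideal P (product_ring S R) \<and>
    (\<exists>k\<in>S. \<exists>\<pp>. primeideal \<pp> (R k) \<and> P = proj k -` \<pp> \<inter> carrier (product_ring S R))"

definition wild_prime :: "'i set \<Rightarrow> ('i \<Rightarrow> ('a, 'm) ring_scheme) \<Rightarrow> ('i \<Rightarrow> 'a) set \<Rightarrow> bool"
  where "wild_prime S R P \<longleftrightarrow> primeideal P (product_ring S R) \<and> \<not> tame_prime S R P"

definition minimal_prime :: "('a, 'm) ring_scheme \<Rightarrow> 'a set \<Rightarrow> bool"
  where "minimal_prime A P \<longleftrightarrow>
    primeideal P A \<and> (\<forall>Q. primeideal Q A \<longrightarrow> Q \<subseteq> P \<longrightarrow> Q = P)"

definition minimal_wild_prime :: "'i set \<Rightarrow> ('i \<Rightarrow> ('a, 'm) ring_scheme) \<Rightarrow> ('i \<Rightarrow> 'a) set \<Rightarrow> bool"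
  where "minimal_wild_prime S R P \<longleftrightarrow> wild_prime S R P \<and> minimal_prime (product_ring S R) P"

lemma product_ring_cring:
  assumes "\<And>k. k \<in> S \<Longrightarrow> cring (R k)"
  shows "cring (product_ring S R)"
proof (rule cringI)
  note defs = product_ring_def PiE_def Pi_def extensional_def
  have r: "ring (R k)" if "k \<in> S" for k using assms[OF that] by (rule cring.axioms)
  show "abelian_group (product_ring S R)"
  proof (rule abelian_groupI, goal_cases)
    case (6 x)
    show ?case
      by (rule bexI[of _ "\<lambda>k\<in>S. \<ominus>\<^bsub>R k\<^esub> x k"])
        (use 6 in \<open>auto simp: defs fun_eq_iff r ring.ring_simprules cong: restrict_cong\<close>)
  qed (auto simp: defs fun_eq_iff r ring.ring_simprules)
  show "comm_monoid (product_ring S R)"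
    by (rule comm_monoidI)
      (auto simp: defs fun_eq_iff r assms cring.cring_simprules ring.is_monoid monoid.r_one)
qed (auto simp: product_ring_def PiE_def Pi_def fun_eq_iff assms cring.cring_simprules)

lemma proj_ring_hom: "k \<in> S \<Longrightarrow> proj k \<in> ring_hom (product_ring S R) (R k)"
  by (auto simp: ring_hom_def proj_def product_ring_def)

end

theory Submission
  imports Defs "HOL-Algebra.Free_Abelian_Groups"
begin

text \<open>A prime ideal \<open>Q\<close> of the product contains exactly one of the complementary idempotents
  \<open>e\<^sub>A\<close>, \<open>e\<^sub>S\<^sub>-\<^sub>A\<close> for each \<open>A \<subseteq> S\<close>, so \<open>{A. e\<^sub>S\<^sub>-\<^sub>A \<in> Q}\<close> is an ultrafilter on \<open>S\<close>. Conversely the families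
  vanishing on a set of an ultrafilter form a prime ideal, and these are precisely the minimal
  primes. The ones coming from nonprincipal ultrafilters are wild. Nonprincipal ultrafilters are counted by
  Pospisil's argument: there are only \<open>|S|\<close> pairs \<open>(F, \<A>)\<close> of a finite \<open>F \<subseteq> S\<close> and a finite set \<open>\<A>\<close> of
  finite subsets of \<open>S\<close>, and the sets of those pairs with \<open>X \<inter> F \<in> \<A>\<close>, for \<open>X \<subseteq> S\<close>, form an
  independent family of \<open>2\<^sup>|\<^sup>S\<^sup>|\<close> members. Adding the sets of pairs with \<open>t \<in> F\<close>, for \<open>t \<in> S\<close>, forces
  nonprincipality.\<close>

section \<open>Ultrafilters\<close>

text \<open>A family of subsets of \<open>S\<close> instead of a filter on the type, so that
  everything stays relative to the index set. The last clause with \<open>A = {}\<close> gives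
  \<open>S \<in> U\<close>.\<close>

definition ultrafilter_on :: "'i set \<Rightarrow> 'i set set \<Rightarrow> bool"
  where "ultrafilter_on S U \<longleftrightarrow> U \<subseteq> Pow S \<and> {} \<notin> U \<and> (\<forall>A\<in>U. \<forall>B\<in>U. A \<inter> B \<in> U) \<and>
    (\<forall>A\<in>U. \<forall>B. A \<subseteq> B \<longrightarrow> B \<subseteq> S \<longrightarrow> B \<in> U) \<and> (\<forall>A. A \<subseteq> S \<longrightarrow> A \<in> U \<or> S - A \<in> U)"

lemma
  assumes "ultrafilter_on S U"
  shows ultrafilter_on_subset: "A \<in> U \<Longrightarrow> A \<subseteq> S"
    and ultrafilter_on_empty: "{} \<notin> U"
    and ultrafilter_on_Int: "A \<in> U \<Longrightarrow> B \<in> U \<Longrightarrow> A \<inter> B \<in> U"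
    and ultrafilter_on_mono: "A \<in> U \<Longrightarrow> A \<subseteq> B \<Longrightarrow> B \<subseteq> S \<Longrightarrow> B \<in> U"
    and ultrafilter_on_compl: "A \<subseteq> S \<Longrightarrow> A \<notin> U \<Longrightarrow> S - A \<in> U"
proof -
  obtain U: "U \<subseteq> Pow S" "{} \<notin> U" "\<forall>A\<in>U. \<forall>B\<in>U. A \<inter> B \<in> U"
    "\<forall>A\<in>U. \<forall>B. A \<subseteq> B \<longrightarrow> B \<subseteq> S \<longrightarrow> B \<in> U" "\<forall>A. A \<subseteq> S \<longrightarrow> A \<in> U \<or> S - A \<in> U"
    using assms unfolding ultrafilter_on_def by (elim conjE) (rule that)
  show "A \<in> U \<Longrightarrow> A \<subseteq> S" using U(1) by blast
  show "{} \<notin> U" by (rule U(2))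
  show "A \<in> U \<Longrightarrow> B \<in> U \<Longrightarrow> A \<inter> B \<in> U" using U(3) by blast
  show "A \<in> U \<Longrightarrow> A \<subseteq> B \<Longrightarrow> B \<subseteq> S \<Longrightarrow> B \<in> U" using U(4) by blast
  show "A \<subseteq> S \<Longrightarrow> A \<notin> U \<Longrightarrow> S - A \<in> U" using U(5) by blast
qed

lemma ultrafilter_on_Diff_iff:
  assumes "ultrafilter_on S U" "A \<subseteq> S"
  shows "S - A \<in> U \<longleftrightarrow> A \<notin> U"
  using ultrafilter_on_Int[OF assms(1), of A "S - A"] ultrafilter_on_empty[OF assms(1)]
    ultrafilter_on_compl[OF assms] by auto

text \<open>Over domains the zero set of a product is the union of the zero sets, so this is what
  makes the ideal of an ultrafilter prime.\<close>

lemma ultrafilter_on_Un: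
  assumes "ultrafilter_on S U" "A \<union> B \<in> U" "A \<subseteq> S" "B \<subseteq> S"
  shows "A \<in> U \<or> B \<in> U"
proof (rule ccontr)
  assume "\<not> ?thesis"
  then have "S - A \<in> U" "S - B \<in> U"
    using assms by (auto simp: ultrafilter_on_Diff_iff)
  then have "(S - A) \<inter> (S - B) \<inter> (A \<union> B) \<in> U"
    using ultrafilter_on_Int[OF assms(1)] assms(2) by blast
  moreover have "(S - A) \<inter> (S - B) \<inter> (A \<union> B) = {}" by blast
  ultimately show False using ultrafilter_on_empty[OF assms(1)] by simp
qed

text \<open>An \<open>A\<close> in \<open>U\<close> but not in \<open>V\<close> would have
  \<open>S - A\<close> in \<open>V\<close>, hence in \<open>U\<close> together with
  \<open>A\<close>. On the ring side this becomes minimality of the prime.\<close>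

lemma ultrafilter_on_maximal:
  assumes U: "ultrafilter_on S U" and V: "ultrafilter_on S V" and "V \<subseteq> U"
  shows "V = U"
proof
  show "U \<subseteq> V"
    using assms(3) ultrafilter_on_Diff_iff[OF U] ultrafilter_on_Diff_iff[OF V]
      ultrafilter_on_subset[OF U] by blast
qed fact

text \<open>Zorn's lemma gives a maximal family with the finite intersection property that contains
  \<open>B\<close>. Intersecting with \<open>S\<close> covers the empty \<open>G\<close>, where
  \<open>\<Inter>G\<close> is the whole type.\<close>

lemma ultrafilter_on_exists:
  assumes B: "B \<subseteq> Pow S"
    and fip: "\<And>G. finite G \<Longrightarrow> G \<subseteq> B \<Longrightarrow> S \<inter> \<Inter>G \<noteq> {}"
  obtains U where "ultrafilter_on S U" "B \<subseteq> U"
proof -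
  define \<F> where "\<F> = {U. B \<subseteq> U \<and> U \<subseteq> Pow S \<and> (\<forall>G. finite G \<longrightarrow> G \<subseteq> U \<longrightarrow> S \<inter> \<Inter>G \<noteq> {})}"
  have "\<exists>U\<in>\<F>. \<forall>X\<in>\<F>. U \<subseteq> X \<longrightarrow> X = U"
  proof (rule subset_Zorn_nonempty)
    have "B \<in> \<F>" using B fip by (simp add: \<F>_def)
    then show "\<F> \<noteq> {}" by blast
  next
    fix \<C> assume ne: "\<C> \<noteq> {}" and ch: "subset.chain \<F> \<C>"
    then have sub: "\<C> \<subseteq> \<F>" by (simp add: subset.chain_def)
    have "S \<inter> \<Inter>G \<noteq> {}" if G: "finite G" "G \<subseteq> \<Union>\<C>" for G
    proof -
      obtain V where V: "V \<in> \<C>" "G \<subseteq> V"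
        by (rule finite_subset_Union_chain[OF G ne ch])
      then have "V \<in> \<F>" using sub by (elim subsetD)
      then show ?thesis using V(2) G(1) by (simp add: \<F>_def)
    qed
    moreover have "B \<subseteq> V" if "V \<in> \<C>" for V
      using subsetD[OF sub that] by (simp add: \<F>_def)
    then have "B \<subseteq> \<Union>\<C>" using ne by blast
    moreover have "\<Union>\<C> \<subseteq> Pow S" using sub by (auto simp: \<F>_def)
    ultimately show "\<Union>\<C> \<in> \<F>" by (simp add: \<F>_def)
  qed
  then obtain U where U: "U \<in> \<F>" and max: "\<And>X. X \<in> \<F> \<Longrightarrow> U \<subseteq> X \<Longrightarrow> X = U" by blast
  have BU: "B \<subseteq> U" and US: "U \<subseteq> Pow S"
    and fipU: "\<And>G. finite G \<Longrightarrow> G \<subseteq> U \<Longrightarrow> S \<inter> \<Inter>G \<noteq> {}"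
    using U by (auto simp: \<F>_def)
  \<comment> \<open>Consequence of maximality: a set meeting every finite intersection from
    \<open>U\<close> can be added without losing the property, so it is in \<open>U\<close> already.
    Each closure condition below reduces to this.\<close>
  have mem: "A \<in> U" if A: "A \<subseteq> S" and meets: "\<And>G. finite G \<Longrightarrow> G \<subseteq> U \<Longrightarrow> A \<inter> \<Inter>G \<noteq> {}" for A
  proof -
    have "S \<inter> \<Inter>G \<noteq> {}" if G: "finite G" "G \<subseteq> insert A U" for G
    proof -
      have "A \<inter> \<Inter>(G - {A}) \<noteq> {}" using G by (intro meets) auto
      then show ?thesis using A by blast
    qed
    then have "insert A U \<in> \<F>" using A BU US by (auto simp: \<F>_def)
    then show ?thesis using max by blast
  qed
  have "A \<inter> B' \<in> U" if "A \<in> U" "B' \<in> U" for A B'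
  proof (rule mem)
    show "A \<inter> B' \<inter> \<Inter>G \<noteq> {}" if "finite G" "G \<subseteq> U" for G
      using fipU[of "insert A (insert B' G)"] that \<open>A \<in> U\<close> \<open>B' \<in> U\<close> by blast
  qed (use that US in blast)
  moreover have "B' \<in> U" if "A \<in> U" "A \<subseteq> B'" "B' \<subseteq> S" for A B'
  proof (rule mem)
    show "B' \<inter> \<Inter>G \<noteq> {}" if "finite G" "G \<subseteq> U" for G
      using fipU[of "insert A G"] that \<open>A \<in> U\<close> \<open>A \<subseteq> B'\<close> by blast
  qed fact
  moreover have "S - A \<in> U" if A: "A \<subseteq> S" "A \<notin> U" for A
  proof (rule mem)
    \<comment> \<open>As \<open>A\<close> is not in \<open>U\<close>, \<open>mem\<close> cannot
      apply to it, so some finite intersection from \<open>U\<close> misses \<open>A\<close>.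
      Joining \<open>H\<close> to any \<open>G\<close> then forces a common point outside
      \<open>A\<close>.\<close>
    obtain H where H: "finite H" "H \<subseteq> U" "A \<inter> \<Inter>H = {}"
      using mem[OF A(1)] A(2) by metis
    show "(S - A) \<inter> \<Inter>G \<noteq> {}" if "finite G" "G \<subseteq> U" for G
    proof -
      have "S \<inter> (\<Inter>G \<inter> \<Inter>H) \<noteq> {}"
        using fipU[of "G \<union> H"] that H(1,2) by (simp add: Inter_Un_distrib)
      then show ?thesis using H(3) by blast
    qed
  qed blast
  then have "A \<in> U \<or> S - A \<in> U" if "A \<subseteq> S" for A using that by blast
  moreover have "{} \<notin> U" using fipU[of "{{}}"] by auto
  ultimately have "ultrafilter_on S U" using US unfolding ultrafilter_on_def by (intro conjI ballI allI impI)
  then show ?thesis using BU by (rule that)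
qed

section \<open>Independent sets and nonprincipal ultrafilters\<close>

lemma Fpow_Times_Fpow_Fpow_eqpoll:
  assumes "infinite S"
  shows "Fpow S \<times> Fpow (Fpow S) \<approx> S"
proof -
  have F: "Fpow S \<approx> S" by (rule eqpoll_Fpow[OF assms])
  then have inf: "infinite (Fpow S)" using assms eqpoll_finite_iff by blast
  have FF: "Fpow (Fpow S) \<approx> S" using eqpoll_Fpow[OF inf] F by (rule eqpoll_trans)
  have "Fpow S \<times> Fpow (Fpow S) \<approx> S \<times> S" by (rule times_eqpoll_cong[OF F FF])
  also have "S \<times> S \<approx> S"
    using card_of_Times_same_infinite[OF assms] by (simp add: eqpoll_iff_card_of_ordIso)
  finally show ?thesis .
qed

text \<open>\<open>C\<close> prescribes which of the sets \<open>A X\<close> belong to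
  \<open>U\<close>, and one \<open>A\<close> serves every \<open>C\<close>. So \<open>C\<close> can
  be read off from \<open>U\<close>, which yields at least as many nonprincipal ultrafilters as
  \<open>Pow (Pow S)\<close> has elements.\<close>

lemma independent_ultrafilters:
  fixes S :: "'i set"
  assumes "infinite S"
  shows "\<exists>A :: 'i set \<Rightarrow> 'i set. \<forall>C \<subseteq> Pow S.
    \<exists>U. ultrafilter_on S U \<and> (\<forall>k\<in>S. {k} \<notin> U) \<and> {X \<in> Pow S. A X \<in> U} = C"
proof -
  \<comment> \<open>The independent family lives on the pairs; \<open>h\<close> carries it over to
    subsets of \<open>S\<close> itself.\<close>
  obtain h where h: "bij_betw h S (Fpow S \<times> Fpow (Fpow S))"
    using eqpoll_sym[OF Fpow_Times_Fpow_Fpow_eqpoll[OF assms]] by (auto simp: eqpoll_def)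
  define A where "A X = {s \<in> S. X \<inter> fst (h s) \<in> snd (h s)}" for X
  define T where "T t = {s \<in> S. t \<in> fst (h s)}" for t
  have "\<exists>U. ultrafilter_on S U \<and> (\<forall>k\<in>S. {k} \<notin> U) \<and> {X \<in> Pow S. A X \<in> U} = C"
    if C: "C \<subseteq> Pow S" for C
  proof -
    define B where "B = A ` C \<union> (\<lambda>X. S - A X) ` (Pow S - C) \<union> T ` S"
    have "B \<subseteq> Pow S" by (auto simp: B_def A_def T_def)
    moreover have "S \<inter> \<Inter>G \<noteq> {}" if "finite G" "G \<subseteq> B" for G
    proof -
      obtain G1 G2 G3 where G: "G = G1 \<union> G2 \<union> G3" "G1 \<subseteq> A ` C"
        "G2 \<subseteq> (\<lambda>X. S - A X) ` (Pow S - C)" "G3 \<subseteq> T ` S"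
        using \<open>G \<subseteq> B\<close> unfolding B_def by (metis subset_UnE)
      then have fin: "finite G1" "finite G2" "finite G3" using \<open>finite G\<close> by auto
      obtain C1 where C1: "C1 \<subseteq> C" "finite C1" "G1 = A ` C1"
        using finite_subset_image[OF fin(1) G(2)] by blast
      obtain C2 where C2: "C2 \<subseteq> Pow S - C" "finite C2" "G2 = (\<lambda>X. S - A X) ` C2"
        using finite_subset_image[OF fin(2) G(3)] by blast
      obtain T3 where T3: "T3 \<subseteq> S" "finite T3" "G3 = T ` T3"
        using finite_subset_image[OF fin(3) G(4)] by blast
      \<comment> \<open>A finite \<open>F\<close> containing a point of the symmetric difference of
        each \<open>X\<close> in \<open>C1\<close> and \<open>Y\<close> in \<open>C2\<close>
        separates their traces; \<open>d\<close> chooses these points. \<open>T3\<close> also goes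
        into \<open>F\<close>, so that the witness lies in each \<open>T t\<close>.\<close>
      have "\<forall>X\<in>C1. \<forall>Y\<in>C2. \<exists>d. d \<in> (X - Y) \<union> (Y - X)"
      proof (intro ballI)
        fix X Y assume "X \<in> C1" "Y \<in> C2"
        then have "X \<noteq> Y" using C1(1) C2(1) by blast
        then show "\<exists>d. d \<in> (X - Y) \<union> (Y - X)" by blast
      qed
      then obtain d where d: "\<And>X Y. X \<in> C1 \<Longrightarrow> Y \<in> C2 \<Longrightarrow> d X Y \<in> (X - Y) \<union> (Y - X)"
        by metis
      define F where "F = T3 \<union> (\<lambda>(X, Y). d X Y) ` (C1 \<times> C2)"
      have dS: "d X Y \<in> S" if "X \<in> C1" "Y \<in> C2" for X Y
        using d[OF that] that C C1(1) C2(1) by blast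
      have F: "F \<in> Fpow S" using dS T3 C1 C2 by (auto simp: F_def Fpow_def)
      have "(\<lambda>X. X \<inter> F) ` C1 \<in> Fpow (Fpow S)" using F C1(2) by (auto simp: Fpow_def)
      \<comment> \<open>The index \<open>s\<close> of \<open>F\<close> paired with the traces of
        \<open>C1\<close> on it is the required common point: no \<open>Y\<close> in
        \<open>C2\<close> has such a trace.\<close>
      with F have "(F, (\<lambda>X. X \<inter> F) ` C1) \<in> h ` S"
        unfolding bij_betw_imp_surj_on[OF h] by (rule SigmaI)
      then obtain s where s: "s \<in> S" "h s = (F, (\<lambda>X. X \<inter> F) ` C1)"
        by (elim imageE) simp
      have "s \<in> A X" if "X \<in> C1" for X using that s by (simp add: A_def)
      moreover have "s \<notin> A Y" if "Y \<in> C2" for Y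
      proof
        assume "s \<in> A Y"
        then obtain X where X: "X \<in> C1" "Y \<inter> F = X \<inter> F" using s by (auto simp: A_def)
        have "d X Y \<in> F" using X that by (auto simp: F_def)
        then show False using d[OF X(1) that] X(2) by blast
      qed
      moreover have "s \<in> T t" if "t \<in> T3" for t using that s by (simp add: T_def F_def)
      ultimately have "s \<in> S \<inter> \<Inter>G" using s(1) G(1) C1(3) C2(3) T3(3) by auto
      then show ?thesis by blast
    qed
    ultimately obtain U where U: "ultrafilter_on S U" "B \<subseteq> U"
      using ultrafilter_on_exists by metis
    have "{k} \<notin> U" if k: "k \<in> S" for k
    proof
      assume kU: "{k} \<in> U"
      \<comment> \<open>\<open>{k}\<close> meets every \<open>T t\<close>, so the finite set
        \<open>fst (h k)\<close> would contain all of \<open>S\<close>.\<close>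
      have "t \<in> fst (h k)" if "t \<in> S" for t
      proof -
        have "T t \<in> U" using that U(2) by (auto simp: B_def)
        then have "{k} \<inter> T t \<noteq> {}"
          using ultrafilter_on_Int[OF U(1) kU] ultrafilter_on_empty[OF U(1)] by metis
        then show ?thesis by (auto simp: T_def)
      qed
      then have "S \<subseteq> fst (h k)" by (rule subsetI)
      moreover have "finite (fst (h k))"
        using bij_betwE[OF h] k by (auto simp: Fpow_def mem_Times_iff)
      ultimately have "finite S" by (rule finite_subset)
      with assms show False by contradiction
    qed
    moreover have "A X \<in> U \<longleftrightarrow> X \<in> C" if "X \<in> Pow S" for X
    proof -
      have "A X \<subseteq> S" by (auto simp: A_def)
      moreover have "X \<in> C \<Longrightarrow> A X \<in> U" "X \<notin> C \<Longrightarrow> S - A X \<in> U"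
        using that U(2) by (auto simp: B_def)
      ultimately show ?thesis using ultrafilter_on_Diff_iff[OF U(1)] by blast
    qed
    ultimately show ?thesis using U(1) C by (intro exI[of _ U]) auto
  qed
  then show ?thesis by (intro exI[of _ A] allI impI)
qed

section \<open>Prime ideals of a product of domains\<close>

text \<open>For an ultrafilter \<open>U\<close>, the kernel of the map from the product to the
  ultraproduct of the \<open>R k\<close>.\<close>

definition ultrafilter_ideal ::
    "'i set \<Rightarrow> ('i \<Rightarrow> ('a, 'm) ring_scheme) \<Rightarrow> 'i set set \<Rightarrow> ('i \<Rightarrow> 'a) set"
  where "ultrafilter_ideal S R U =
    {x \<in> carrier (product_ring S R). {k \<in> S. x k = \<zero>\<^bsub>R k\<^esub>} \<in> U}"

definition set_idempotent :: "'i set \<Rightarrow> ('i \<Rightarrow> ('a, 'm) ring_scheme) \<Rightarrow> 'i set \<Rightarrow> 'i \<Rightarrow> 'a"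
  where "set_idempotent S R A = (\<lambda>k\<in>S. if k \<in> A then \<one>\<^bsub>R k\<^esub> else \<zero>\<^bsub>R k\<^esub>)"

text \<open>The complement appears because the idempotent of \<open>S - A\<close> has zero set
  \<open>A\<close>; in this form an ultrafilter is recovered from its ideal.\<close>

definition ideal_ultrafilter ::
    "'i set \<Rightarrow> ('i \<Rightarrow> ('a, 'm) ring_scheme) \<Rightarrow> ('i \<Rightarrow> 'a) set \<Rightarrow> 'i set set"
  where "ideal_ultrafilter S R Q = {A. A \<subseteq> S \<and> set_idempotent S R (S - A) \<in> Q}"

context
  fixes S :: "'i set" and R :: "'i \<Rightarrow> ('a, 'm) ring_scheme"
  assumes domains: "\<And>k. k \<in> S \<Longrightarrow> domain (R k)"
begin

lemma factor_cring: "k \<in> S \<Longrightarrow> cring (R k)"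
  using domains by (simp add: domain_def)

lemma factor_ring: "k \<in> S \<Longrightarrow> ring (R k)"
  using factor_cring by (rule cring.axioms)

lemma product_cring: "cring (product_ring S R)"
  by (rule product_ring_cring[OF factor_cring])

lemma product_carrierD: "x \<in> carrier (product_ring S R) \<Longrightarrow> k \<in> S \<Longrightarrow> x k \<in> carrier (R k)"
  by (auto simp: product_ring_def)

lemma product_carrier_eqI:
  assumes "x \<in> carrier (product_ring S R)" "y \<in> carrier (product_ring S R)"
    and "\<And>k. k \<in> S \<Longrightarrow> x k = y k"
  shows "x = y"
  using assms by (auto simp: product_ring_def intro: PiE_ext)

lemma product_simps:
  assumes "k \<in> S"
  shows "(x \<otimes>\<^bsub>product_ring S R\<^esub> y) k = x k \<otimes>\<^bsub>R k\<^esub> y k"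
    and "(x \<oplus>\<^bsub>product_ring S R\<^esub> y) k = x k \<oplus>\<^bsub>R k\<^esub> y k"
    and "\<one>\<^bsub>product_ring S R\<^esub> k = \<one>\<^bsub>R k\<^esub>"
    and "\<zero>\<^bsub>product_ring S R\<^esub> k = \<zero>\<^bsub>R k\<^esub>"
  using assms by (simp_all add: product_ring_def)

lemma factor_one_not_zero: "k \<in> S \<Longrightarrow> \<one>\<^bsub>R k\<^esub> \<noteq> \<zero>\<^bsub>R k\<^esub>"
  using domains by (simp add: domain.one_not_zero)

lemma set_idempotent_closed: "set_idempotent S R A \<in> carrier (product_ring S R)"
  by (auto simp: set_idempotent_def product_ring_def factor_ring ring.ring_simprules)

lemma set_idempotent_apply: "k \<in> S \<Longrightarrow> set_idempotent S R A k = (if k \<in> A then \<one>\<^bsub>R k\<^esub> else \<zero>\<^bsub>R k\<^esub>)"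
  by (simp add: set_idempotent_def)

lemma ultrafilter_ideal_prime:
  assumes U: "ultrafilter_on S U"
  shows "primeideal (ultrafilter_ideal S R U) (product_ring S R)"
proof -
  let ?P = "product_ring S R" and ?I = "ultrafilter_ideal S R U"
  interpret P: cring ?P by (rule product_cring)
  \<comment> \<open>Membership depends only on the zero set, and a larger zero set preserves
    it.\<close>
  have mem: "x \<in> ?I"
    if "y \<in> ?I" "x \<in> carrier ?P" "\<And>k. k \<in> S \<Longrightarrow> y k = \<zero>\<^bsub>R k\<^esub> \<Longrightarrow> x k = \<zero>\<^bsub>R k\<^esub>" for x y
    using that ultrafilter_on_mono[OF U, of "{k \<in> S. y k = \<zero>\<^bsub>R k\<^esub>}" "{k \<in> S. x k = \<zero>\<^bsub>R k\<^esub>}"]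
    by (auto simp: ultrafilter_ideal_def)
  have sub: "?I \<subseteq> carrier ?P" by (auto simp: ultrafilter_ideal_def)
  have mult: "x \<otimes>\<^bsub>?P\<^esub> a \<in> ?I" if "a \<in> ?I" "x \<in> carrier ?P" for a x
    by (rule mem[OF that(1)])
      (use that sub in \<open>auto simp: product_simps factor_ring ring.ring_simprules product_carrierD\<close>)
  have add: "x \<oplus>\<^bsub>?P\<^esub> y \<in> ?I" if xy: "x \<in> ?I" "y \<in> ?I" for x y
  proof -
    have "{k \<in> S. x k = \<zero>\<^bsub>R k\<^esub>} \<inter> {k \<in> S. y k = \<zero>\<^bsub>R k\<^esub>} \<in> U"
      using xy ultrafilter_on_Int[OF U] by (simp add: ultrafilter_ideal_def)
    then have "{k \<in> S. (x \<oplus>\<^bsub>?P\<^esub> y) k = \<zero>\<^bsub>R k\<^esub>} \<in> U"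
      by (rule ultrafilter_on_mono[OF U]) (auto simp: product_simps factor_ring ring.ring_simprules)
    then show ?thesis using xy sub by (auto simp: ultrafilter_ideal_def)
  qed
  have S: "S \<in> U" using ultrafilter_on_empty[OF U] ultrafilter_on_compl[OF U, of "{}"] by simp
  show ?thesis
  proof (rule primeidealI)
    show "ideal ?I ?P"
    proof (rule idealI)
      show "subgroup ?I (add_monoid ?P)"
      proof (rule P.add.subgroupI)
        have "{k \<in> S. \<zero>\<^bsub>?P\<^esub> k = \<zero>\<^bsub>R k\<^esub>} = S" by (auto simp: product_simps)
        then have "\<zero>\<^bsub>?P\<^esub> \<in> ?I" using S by (simp add: ultrafilter_ideal_def)
        then show "?I \<noteq> {}" by blast
        \<comment> \<open>Negation is multiplication by \<open>-1\<close>, which \<open>mult\<close>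
          covers.\<close>
        show "\<ominus>\<^bsub>?P\<^esub> a \<in> ?I" if "a \<in> ?I" for a
          using mult[OF that, of "\<ominus>\<^bsub>?P\<^esub> \<one>\<^bsub>?P\<^esub>"] that sub by (simp add: P.l_minus subset_iff)
      qed (use sub add in auto)
      show "a \<otimes>\<^bsub>?P\<^esub> x \<in> ?I" if "a \<in> ?I" "x \<in> carrier ?P" for a x
        using mult[OF that] that sub by (simp add: P.m_comm subset_iff)
    qed (use mult P.ring_axioms in auto)
    show "cring ?P" by (rule P.is_cring)
    have "{k \<in> S. \<one>\<^bsub>?P\<^esub> k = \<zero>\<^bsub>R k\<^esub>} = {}"
      by (auto simp: product_simps factor_one_not_zero)
    then have "\<one>\<^bsub>?P\<^esub> \<notin> ?I"
      using ultrafilter_on_empty[OF U]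
      by (simp add: ultrafilter_ideal_def del: Collect_empty_eq)
    then show "carrier ?P \<noteq> ?I" by auto
    show "a \<in> ?I \<or> b \<in> ?I"
      if ab: "a \<in> carrier ?P" "b \<in> carrier ?P" "a \<otimes>\<^bsub>?P\<^esub> b \<in> ?I" for a b
    proof -
      have "(a \<otimes>\<^bsub>?P\<^esub> b) k = \<zero>\<^bsub>R k\<^esub> \<longleftrightarrow> a k = \<zero>\<^bsub>R k\<^esub> \<or> b k = \<zero>\<^bsub>R k\<^esub>" if "k \<in> S" for k
        using domain.integral_iff[OF domains[OF that]] ab(1,2) that
        by (simp add: product_simps product_carrierD)
      then have "{k \<in> S. (a \<otimes>\<^bsub>?P\<^esub> b) k = \<zero>\<^bsub>R k\<^esub>} = {k \<in> S. a k = \<zero>\<^bsub>R k\<^esub>} \<union> {k \<in> S. b k = \<zero>\<^bsub>R k\<^esub>}"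
        by blast
      then show ?thesis
        using ab ultrafilter_on_Un[OF U, of "{k \<in> S. a k = \<zero>\<^bsub>R k\<^esub>}" "{k \<in> S. b k = \<zero>\<^bsub>R k\<^esub>}"]
        by (auto simp: ultrafilter_ideal_def)
    qed
  qed
qed

section \<open>The correspondence between primes and ultrafilters\<close>

lemma set_idempotent_mem_ultrafilter_ideal:
  assumes "A \<subseteq> S"
  shows "set_idempotent S R (S - A) \<in> ultrafilter_ideal S R U \<longleftrightarrow> A \<in> U"
proof -
  have "{k \<in> S. set_idempotent S R (S - A) k = \<zero>\<^bsub>R k\<^esub>} = A"
    using assms by (auto simp: set_idempotent_apply factor_one_not_zero split: if_splits)
  then show ?thesis by (simp add: ultrafilter_ideal_def set_idempotent_closed)
qed

lemma ideal_ultrafilter_ultrafilter_ideal: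
  assumes "ultrafilter_on S U"
  shows "ideal_ultrafilter S R (ultrafilter_ideal S R U) = U"
  using ultrafilter_on_subset[OF assms]
  by (auto simp: ideal_ultrafilter_def set_idempotent_mem_ultrafilter_ideal)

text \<open>Complements turn ideal properties into filter properties: sums give intersections,
  absorption gives upward closure, and \<open>1 \<notin> Q\<close> keeps out \<open>{}\<close>. The
  dichotomy is primality applied to the zero product of two complementary idempotents.\<close>

lemma ideal_ultrafilter_ultrafilter_on:
  assumes Q: "primeideal Q (product_ring S R)"
  shows "ultrafilter_on S (ideal_ultrafilter S R Q)"
proof -
  let ?P = "product_ring S R" and ?e = "set_idempotent S R"
  interpret Q: primeideal Q ?P by (rule Q)
  have mult: "?e (A \<inter> B) \<in> Q" if "?e A \<in> Q" for A B
  proof -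
    have "?e (A \<inter> B) = ?e A \<otimes>\<^bsub>?P\<^esub> ?e B"
      by (rule product_carrier_eqI)
        (auto simp: set_idempotent_closed product_simps set_idempotent_apply factor_ring ring.ring_simprules)
    then show ?thesis using that Q.I_r_closed set_idempotent_closed by simp
  qed
  have mono: "?e B \<in> Q" if "?e A \<in> Q" "B \<subseteq> A" for A B
    using mult[OF that(1), of B] that(2) by (simp add: Int_absorb1)
  have Un: "?e (A \<union> B) \<in> Q" if "?e A \<in> Q" "?e B \<in> Q" for A B
  proof -
    \<comment> \<open>\<open>B - A\<close> instead of \<open>B\<close>: idempotents of overlapping
      sets would add up to \<open>1 + 1\<close> on the overlap.\<close>
    have "?e (A \<union> B) = ?e A \<oplus>\<^bsub>?P\<^esub> ?e (B - A)"
      by (rule product_carrier_eqI)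
        (auto simp: set_idempotent_closed product_simps set_idempotent_apply factor_ring ring.ring_simprules)
    then show ?thesis using that mono[OF that(2), of "B - A"] by auto
  qed
  have "?e S = \<one>\<^bsub>?P\<^esub>"
    by (rule product_carrier_eqI) (auto simp: set_idempotent_closed product_simps set_idempotent_apply)
  then have "?e S \<notin> Q" using Q.one_imp_carrier Q.I_notcarr by auto
  moreover have "?e (S - A) \<in> Q \<or> ?e A \<in> Q" for A
  proof (rule Q.I_prime)
    have "?e (S - A) \<otimes>\<^bsub>?P\<^esub> ?e A = \<zero>\<^bsub>?P\<^esub>"
      by (rule product_carrier_eqI)
        (auto simp: set_idempotent_closed product_simps set_idempotent_apply factor_ring ring.ring_simprules)
    then show "?e (S - A) \<otimes>\<^bsub>?P\<^esub> ?e A \<in> Q" by simp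
  qed (simp_all add: set_idempotent_closed)
  moreover have "?e (S - (A \<inter> B)) \<in> Q" if "?e (S - A) \<in> Q" "?e (S - B) \<in> Q" for A B
    using Un[OF that] by (simp add: Diff_Int)
  moreover have "?e (S - B) \<in> Q" if "?e (S - A) \<in> Q" "A \<subseteq> B" for A B
    using mono[OF that(1)] that(2) by blast
  ultimately show ?thesis
    unfolding ultrafilter_on_def ideal_ultrafilter_def by (auto simp: double_diff)
qed

text \<open>A family is unchanged by multiplication with the idempotent of its support, and that
  idempotent is in \<open>Q\<close> exactly when the zero set is in the ultrafilter of
  \<open>Q\<close>.\<close>

lemma ultrafilter_ideal_subset:
  assumes Q: "primeideal Q (product_ring S R)"
  shows "ultrafilter_ideal S R (ideal_ultrafilter S R Q) \<subseteq> Q"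
proof
  interpret Q: primeideal Q "product_ring S R" by (rule Q)
  fix x assume x: "x \<in> ultrafilter_ideal S R (ideal_ultrafilter S R Q)"
  define e where "e = set_idempotent S R (S - {k \<in> S. x k = \<zero>\<^bsub>R k\<^esub>})"
  have xc: "x \<in> carrier (product_ring S R)" and e: "e \<in> Q"
    using x by (auto simp: ultrafilter_ideal_def ideal_ultrafilter_def e_def)
  have "x = x \<otimes>\<^bsub>product_ring S R\<^esub> e"
    by (rule product_carrier_eqI)
      (use xc in \<open>auto simp: e_def set_idempotent_closed product_simps set_idempotent_apply
        product_carrierD factor_ring ring.ring_simprules monoid.r_one ring.is_monoid\<close>)
  then show "x \<in> Q" using Q.I_l_closed[OF e xc] by simp
qed

text \<open>A smaller prime \<open>Q\<close> has a smaller ultrafilter, which is \<open>U\<close>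
  itself by maximality; then \<open>Q\<close> contains the whole ideal of \<open>U\<close>.\<close>

lemma ultrafilter_ideal_minimal:
  assumes U: "ultrafilter_on S U"
  shows "minimal_prime (product_ring S R) (ultrafilter_ideal S R U)"
proof -
  have "Q = ultrafilter_ideal S R U"
    if Q: "primeideal Q (product_ring S R)" and sub: "Q \<subseteq> ultrafilter_ideal S R U" for Q
  proof -
    have "ideal_ultrafilter S R Q \<subseteq> ideal_ultrafilter S R (ultrafilter_ideal S R U)"
      using sub by (auto simp: ideal_ultrafilter_def)
    then have "ideal_ultrafilter S R Q = U"
      using ultrafilter_on_maximal[OF U ideal_ultrafilter_ultrafilter_on[OF Q]]
      by (simp add: ideal_ultrafilter_ultrafilter_ideal[OF U])
    then show ?thesis using ultrafilter_ideal_subset[OF Q] sub by simp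
  qed
  then show ?thesis using ultrafilter_ideal_prime[OF U] by (auto simp: minimal_prime_def)
qed

text \<open>The ideal of the ultrafilter of \<open>Q\<close> is a prime inside \<open>Q\<close>, so
  minimality forces equality. Hence a minimal prime is determined by its ultrafilter.\<close>

lemma minimal_prime_eq_ultrafilter_ideal:
  assumes "minimal_prime (product_ring S R) Q"
  shows "ultrafilter_ideal S R (ideal_ultrafilter S R Q) = Q"
  using assms ultrafilter_ideal_prime[OF ideal_ultrafilter_ultrafilter_on] ultrafilter_ideal_subset
  unfolding minimal_prime_def by blast

section \<open>Wildness and the cardinality\<close>

lemma ultrafilter_ideal_minimal_wild:
  assumes U: "ultrafilter_on S U" and nonprincipal: "\<And>k. k \<in> S \<Longrightarrow> {k} \<notin> U"
  shows "minimal_wild_prime S R (ultrafilter_ideal S R U)"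
proof -
  have "\<not> tame_prime S R (ultrafilter_ideal S R U)"
  proof
    assume "tame_prime S R (ultrafilter_ideal S R U)"
    then obtain k \<pp> where k: "k \<in> S" and \<pp>: "primeideal \<pp> (R k)"
      and eq: "ultrafilter_ideal S R U = proj k -` \<pp> \<inter> carrier (product_ring S R)"
      unfolding tame_prime_def by blast
    interpret \<pp>: primeideal \<pp> "R k" by (rule \<pp>)
    \<comment> \<open>This idempotent is zero at \<open>k\<close>, so every tame prime over
      \<open>k\<close> contains it; its zero set \<open>{k}\<close> would then be in
      \<open>U\<close>.\<close>
    have "set_idempotent S R (S - {k}) \<in> ultrafilter_ideal S R U"
      unfolding eq using k by (simp add: proj_def set_idempotent_closed set_idempotent_apply)
    then show False
      using k nonprincipal by (simp add: set_idempotent_mem_ultrafilter_ideal)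
  qed
  then show ?thesis
    using ultrafilter_ideal_prime[OF U] ultrafilter_ideal_minimal[OF U]
    by (simp add: minimal_wild_prime_def wild_prime_def)
qed

end

theorem theorem2p17:
  fixes S :: "'i set" and R :: "'i \<Rightarrow> ('a, 'm) ring_scheme"
  assumes "infinite S"
    and "\<And>k. k \<in> S \<Longrightarrow> domain (R k)"
  shows "{P. minimal_wild_prime S R P} \<approx> Pow (Pow S)"
proof (rule lepoll_antisym)
  \<comment> \<open>Upper bound: sending a minimal prime to its ultrafilter loses nothing.\<close>
  have "inj_on (ideal_ultrafilter S R) {P. minimal_wild_prime S R P}"
    by (rule inj_on_inverseI[where g = "ultrafilter_ideal S R"])
      (simp add: minimal_wild_prime_def minimal_prime_eq_ultrafilter_ideal[OF assms(2)])
  moreover have "ideal_ultrafilter S R ` {P. minimal_wild_prime S R P} \<subseteq> Pow (Pow S)"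
    by (auto simp: ideal_ultrafilter_def)
  ultimately show "{P. minimal_wild_prime S R P} \<lesssim> Pow (Pow S)"
    unfolding lepoll_def by blast
next
  obtain A :: "'i set \<Rightarrow> 'i set" where A: "\<forall>C \<subseteq> Pow S.
      \<exists>U. ultrafilter_on S U \<and> (\<forall>k\<in>S. {k} \<notin> U) \<and> {X \<in> Pow S. A X \<in> U} = C"
    using independent_ultrafilters[OF assms(1)] ..
  \<comment> \<open>Lower bound: one nonprincipal ultrafilter is chosen for each
    \<open>C\<close>.\<close>
  define U where "U C =
    (SOME U. ultrafilter_on S U \<and> (\<forall>k\<in>S. {k} \<notin> U) \<and> {X \<in> Pow S. A X \<in> U} = C)" for C
  have U: "ultrafilter_on S (U C) \<and> (\<forall>k\<in>S. {k} \<notin> U C) \<and> {X \<in> Pow S. A X \<in> U C} = C"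
    if "C \<subseteq> Pow S" for C
    using someI_ex[OF A[rule_format, OF that]] unfolding U_def .
  define J where "J C = ultrafilter_ideal S R (U C)" for C
  \<comment> \<open>The ideal \<open>J C\<close> determines \<open>U C\<close>, which determines
    \<open>C\<close>.\<close>
  have "{X \<in> Pow S. A X \<in> ideal_ultrafilter S R (J C)} = C" if "C \<in> Pow (Pow S)" for C
    using that U[of C] ideal_ultrafilter_ultrafilter_ideal[OF assms(2), where U = "U C"]
    by (simp add: J_def)
  then have "inj_on J (Pow (Pow S))" by (rule inj_on_inverseI)
  moreover have "minimal_wild_prime S R (J C)" if "C \<subseteq> Pow S" for C
    unfolding J_def
    by (rule ultrafilter_ideal_minimal_wild[OF assms(2)]) (use U[OF that] in blast)+
  then have "J ` Pow (Pow S) \<subseteq> {P. minimal_wild_prime S R P}" by auto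
  ultimately show "Pow (Pow S) \<lesssim> {P. minimal_wild_prime S R P}"
    unfolding lepoll_def by blast
qed

end
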